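(* Let $T>0$ and $n\ge1$, and let $C^1_{0,0}([0,T],\mathbb{R}^n)$ be the space of continuously differentiable functions $x:[0,T]\to\mathbb{R}^n$ with $x(0)=x(T)=0$, equipped with the $C^1$ norm. There exists an inner product on the topological dual space $(C^1_{0,0}([0,T],\mathbb{R}^n))^*$ which, as a function $(C^1_{0,0}([0,T],\mathbb{R}^n))^*\times(C^1_{0,0}([0,T],\mathbb{R}^n))^*\to\mathbb{R}$, is continuous with respect to the usual (dual norm) topology of the product space.
   Context: The inner product is not required to induce the dual norm topology. *)

theory Defs
  imports "HOL-Analysis.Analysis"
begin

text \<open>
  A function on the interval \<open>[0,T]\<close> vanishing at both endpoints is represented by its extension
  by zero to the real line. This representation is unique and is closed under the pointwise vector
  space operations. Derivatives are taken within \<open>[0,T]\<close>, hence are one-sided at the endpoints; the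
  library predicate \<open>C1_differentiable_on\<close> would demand two-sided derivatives there.
\<close>

definition C1_00 :: "real \<Rightarrow> (real \<Rightarrow> real ^ 'n) set" where
  "C1_00 T = {x. (\<forall>t. t \<notin> {0..T} \<longrightarrow> x t = 0) \<and> x 0 = 0 \<and> x T = 0 \<and>
     (\<exists>x'. continuous_on {0..T} x' \<and>
           (\<forall>t\<in>{0..T}. (x has_vector_derivative x' t) (at t within {0..T})))}"

definition C1_norm :: "real \<Rightarrow> (real \<Rightarrow> real ^ 'n) \<Rightarrow> real" where
  "C1_norm T x = (SUP t\<in>{0..T}. norm (x t))
               + (SUP t\<in>{0..T}. norm (vector_derivative x (at t within {0..T})))"

text \<open>
  The locale \<^locale>\<open>Metric_space\<close> asks for a nonnegative symmetric distance even outside the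
  carrier, whence the conditional in the definitions of the distances. The values outside the
  carrier do not influence the metric topology.
\<close>

definition C1_dist :: "real \<Rightarrow> (real \<Rightarrow> real ^ 'n) \<Rightarrow> (real \<Rightarrow> real ^ 'n) \<Rightarrow> real" where
  "C1_dist T x y = (if x \<in> C1_00 T \<and> y \<in> C1_00 T then C1_norm T (\<lambda>t. x t - y t) else 0)"

definition C1_topology :: "real \<Rightarrow> (real \<Rightarrow> real ^ 'n) topology" where
  "C1_topology T = Metric_space.mtopology (C1_00 T) (C1_dist T)"

text \<open>
  Functionals on \<^term>\<open>C1_00 T\<close> are total HOL functions; requiring the value \<open>0\<close> outside
  \<^term>\<open>C1_00 T\<close> makes this representation unique.
\<close>

definition C1_dual :: "real \<Rightarrow> ((real \<Rightarrow> real ^ 'n) \<Rightarrow> real) set" where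
  "C1_dual T = {L. (\<forall>x. x \<notin> C1_00 T \<longrightarrow> L x = 0) \<and>
     (\<forall>x\<in>C1_00 T. \<forall>y\<in>C1_00 T. L (\<lambda>t. x t + y t) = L x + L y) \<and>
     (\<forall>c. \<forall>x\<in>C1_00 T. L (\<lambda>t. c *\<^sub>R x t) = c * L x) \<and>
     continuous_map (C1_topology T) euclideanreal L}"

definition dual_norm :: "real \<Rightarrow> ((real \<Rightarrow> real ^ 'n) \<Rightarrow> real) \<Rightarrow> real" where
  "dual_norm T L = (SUP x\<in>{x \<in> C1_00 T. C1_norm T x \<le> 1}. \<bar>L x\<bar>)"

definition dual_dist ::
    "real \<Rightarrow> ((real \<Rightarrow> real ^ 'n) \<Rightarrow> real) \<Rightarrow> ((real \<Rightarrow> real ^ 'n) \<Rightarrow> real) \<Rightarrow> real" where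
  "dual_dist T L M = (if L \<in> C1_dual T \<and> M \<in> C1_dual T then dual_norm T (\<lambda>x. L x - M x) else 0)"

definition dual_topology :: "real \<Rightarrow> ((real \<Rightarrow> real ^ 'n) \<Rightarrow> real) topology" where
  "dual_topology T = Metric_space.mtopology (C1_dual T) (dual_dist T)"

text \<open>Real inner products on a linear space \<open>V\<close> of real-valued functions with pointwise operations.\<close>

definition inner_product_on :: "('a \<Rightarrow> real) set \<Rightarrow> (('a \<Rightarrow> real) \<Rightarrow> ('a \<Rightarrow> real) \<Rightarrow> real) \<Rightarrow> bool" where
  "inner_product_on V B \<longleftrightarrow>
     (\<forall>f\<in>V. \<forall>g\<in>V. B f g = B g f) \<and>
     (\<forall>f\<in>V. \<forall>g\<in>V. \<forall>h\<in>V. B (\<lambda>x. f x + g x) h = B f h + B g h) \<and>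
     (\<forall>c. \<forall>f\<in>V. \<forall>g\<in>V. B (\<lambda>x. c * f x) g = c * B f g) \<and>
     (\<forall>f\<in>V. 0 \<le> B f f) \<and>
     (\<forall>f\<in>V. B f f = 0 \<longleftrightarrow> f = (\<lambda>x. 0))"


subsection \<open>The two distances are metrics\<close>

lemma C1_00_D:
  fixes x :: "real \<Rightarrow> real ^ 'n"
  assumes "T > 0" "x \<in> C1_00 T"
  defines "d \<equiv> \<lambda>t. vector_derivative x (at t within {0..T})"
  shows "\<And>t. t \<in> {0..T} \<Longrightarrow> (x has_vector_derivative d t) (at t within {0..T})"
    and "continuous_on {0..T} d" and "continuous_on {0..T} x"
    and "bdd_above ((\<lambda>t. norm (x t)) ` {0..T})"
    and "bdd_above ((\<lambda>t. norm (d t)) ` {0..T})"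
proof -
  obtain x' where c: "continuous_on {0..T} x'"
    and x': "\<And>t. t \<in> {0..T} \<Longrightarrow> (x has_vector_derivative x' t) (at t within {0..T})"
    using assms(2) by (auto simp: C1_00_def)
  have eq: "d t = x' t" if "t \<in> {0..T}" for t
    unfolding d_def using that x'[OF that] assms(1)
    by (intro vector_derivative_within_cbox[where a=0 and b=T, simplified]) auto
  show der: "(x has_vector_derivative d t) (at t within {0..T})" if "t \<in> {0..T}" for t
    using x'[OF that] eq[OF that] by simp
  show cd: "continuous_on {0..T} d"
    using c eq continuous_on_cong[of "{0..T}" "{0..T}" d x'] by blast
  show cx: "continuous_on {0..T} x"
    using der by (meson continuous_on_eq_continuous_within has_vector_derivative_continuous)
  show "bdd_above ((\<lambda>t. norm (x t)) ` {0..T})"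
    by (intro bounded_imp_bdd_above compact_imp_bounded compact_continuous_image
        continuous_on_norm cx compact_Icc)
  show "bdd_above ((\<lambda>t. norm (d t)) ` {0..T})"
    by (intro bounded_imp_bdd_above compact_imp_bounded compact_continuous_image
        continuous_on_norm cd compact_Icc)
qed

lemma C1_00_add:
  fixes x y :: "real \<Rightarrow> real ^ 'n"
  assumes "x \<in> C1_00 T" "y \<in> C1_00 T"
  shows "(\<lambda>t. x t + y t) \<in> C1_00 T"
proof -
  obtain x' y' where "continuous_on {0..T} x'" "continuous_on {0..T} y'"
    and "\<And>t. t \<in> {0..T} \<Longrightarrow> (x has_vector_derivative x' t) (at t within {0..T})"
    and "\<And>t. t \<in> {0..T} \<Longrightarrow> (y has_vector_derivative y' t) (at t within {0..T})"
    using assms by (auto simp: C1_00_def)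
  then show ?thesis
    using assms unfolding C1_00_def
    by (auto intro!: exI[of _ "\<lambda>t. x' t + y' t"] continuous_on_add has_vector_derivative_add)
qed

lemma C1_00_scaleR:
  fixes x :: "real \<Rightarrow> real ^ 'n"
  assumes "x \<in> C1_00 T"
  shows "(\<lambda>t. c *\<^sub>R x t) \<in> C1_00 T"
proof -
  obtain x' where "continuous_on {0..T} x'"
    and "\<And>t. t \<in> {0..T} \<Longrightarrow> (x has_vector_derivative x' t) (at t within {0..T})"
    using assms by (auto simp: C1_00_def)
  then show ?thesis
    using assms unfolding C1_00_def
    by (auto intro!: exI[of _ "\<lambda>t. c *\<^sub>R x' t"] continuous_intros
        bounded_linear.has_vector_derivative[OF bounded_linear_scaleR_right])
qed

lemma C1_00_diff:
  fixes x y :: "real \<Rightarrow> real ^ 'n"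
  assumes "x \<in> C1_00 T" "y \<in> C1_00 T"
  shows "(\<lambda>t. x t - y t) \<in> C1_00 T"
  using C1_00_add[OF assms(1) C1_00_scaleR[OF assms(2), of "-1"]] by simp

lemma C1_00_zero: "(\<lambda>t. 0 :: real ^ 'n) \<in> C1_00 T"
  by (auto simp: C1_00_def intro!: exI[of _ "\<lambda>t. 0"])

lemma vderiv_C1_00_unique:
  fixes f :: "real \<Rightarrow> real ^ 'n"
  assumes "T > 0" "t \<in> {0..T}" "(f has_vector_derivative f') (at t within {0..T})"
  shows "vector_derivative f (at t within {0..T}) = f'"
  using assms by (intro vector_derivative_within_cbox[where a=0 and b=T, simplified]) auto

lemma C1_norm_bounds:
  fixes x :: "real \<Rightarrow> real ^ 'n"
  assumes "T > 0" "x \<in> C1_00 T"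
  shows "0 \<le> C1_norm T x" and "\<And>t. t \<in> {0..T} \<Longrightarrow> norm (x t) \<le> C1_norm T x"
proof -
  note D = C1_00_D[OF assms]
  have T0: "0 \<in> {0..T}" using assms by auto
  have 1: "norm (x t) \<le> (SUP t\<in>{0..T}. norm (x t))" if "t \<in> {0..T}" for t
    by (rule cSUP_upper[OF that D(4)])
  have 2: "0 \<le> (SUP t\<in>{0..T}. norm (vector_derivative x (at t within {0..T})))"
    using cSUP_upper[OF T0 D(5)] norm_ge_zero order_trans by blast
  show "norm (x t) \<le> C1_norm T x" if "t \<in> {0..T}" for t
    using 1[OF that] 2 by (simp add: C1_norm_def)
  from this[OF T0] show "0 \<le> C1_norm T x"
    using norm_ge_zero order_trans by blast
qed

lemma C1_norm_eq_0_iff: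
  fixes x :: "real \<Rightarrow> real ^ 'n"
  assumes "T > 0" "x \<in> C1_00 T"
  shows "C1_norm T x = 0 \<longleftrightarrow> x = (\<lambda>t. 0)"
proof
  assume "C1_norm T x = 0"
  then have "x t = 0" if "t \<in> {0..T}" for t
    using C1_norm_bounds(2)[OF assms that] by simp
  then show "x = (\<lambda>t. 0)"
    using assms(2) by (auto simp: C1_00_def)
next
  assume "x = (\<lambda>t. 0)"
  moreover have "(SUP t\<in>{0..T}. norm (vector_derivative (\<lambda>t. 0 :: real ^ 'n) (at t within {0..T})))
               = (SUP t\<in>{0..T}. 0)"
    using assms(1) by (intro SUP_cong) (auto simp: vderiv_C1_00_unique)
  ultimately show "C1_norm T x = 0"
    using assms(1) by (simp add: C1_norm_def)
qed

lemma C1_norm_add: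
  fixes x y :: "real \<Rightarrow> real ^ 'n"
  assumes "T > 0" "x \<in> C1_00 T" "y \<in> C1_00 T"
  shows "C1_norm T (\<lambda>t. x t + y t) \<le> C1_norm T x + C1_norm T y"
proof -
  note X = C1_00_D[OF assms(1,2)] and Y = C1_00_D[OF assms(1,3)]
  have ne: "{0..T} \<noteq> {}" using assms(1) by auto
  let ?d = "\<lambda>f t. vector_derivative f (at t within {0..T})"
  have "norm (x t + y t) \<le> (SUP t\<in>{0..T}. norm (x t)) + (SUP t\<in>{0..T}. norm (y t))"
    if "t \<in> {0..T}" for t
    using cSUP_upper[OF that X(4)] cSUP_upper[OF that Y(4)] norm_triangle_ineq[of "x t" "y t"]
    by linarith
  then have 1: "(SUP t\<in>{0..T}. norm (x t + y t))
      \<le> (SUP t\<in>{0..T}. norm (x t)) + (SUP t\<in>{0..T}. norm (y t))"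
    using ne by (intro cSUP_least)
  have "norm (?d (\<lambda>t. x t + y t) t) \<le> (SUP t\<in>{0..T}. norm (?d x t)) + (SUP t\<in>{0..T}. norm (?d y t))"
    if "t \<in> {0..T}" for t
  proof -
    have "?d (\<lambda>t. x t + y t) t = ?d x t + ?d y t"
      using that by (intro vderiv_C1_00_unique assms(1) has_vector_derivative_add X(1) Y(1))
    then show ?thesis
      using cSUP_upper[OF that X(5)] cSUP_upper[OF that Y(5)]
        norm_triangle_ineq[of "?d x t" "?d y t"] by simp
  qed
  then have 2: "(SUP t\<in>{0..T}. norm (?d (\<lambda>t. x t + y t) t))
      \<le> (SUP t\<in>{0..T}. norm (?d x t)) + (SUP t\<in>{0..T}. norm (?d y t))"
    using ne by (intro cSUP_least)
  show ?thesis using 1 2 by (simp add: C1_norm_def)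
qed

lemma C1_norm_scaleR:
  fixes x :: "real \<Rightarrow> real ^ 'n"
  assumes "T > 0" "x \<in> C1_00 T"
  shows "C1_norm T (\<lambda>t. c *\<^sub>R x t) = \<bar>c\<bar> * C1_norm T x"
proof -
  have le: "C1_norm T (\<lambda>t. c *\<^sub>R x t) \<le> \<bar>c\<bar> * C1_norm T x"
    if x: "x \<in> C1_00 T" for c and x :: "real \<Rightarrow> real ^ 'n"
  proof -
    note X = C1_00_D[OF assms(1) x]
    have ne: "{0..T} \<noteq> {}" using assms(1) by auto
    let ?d = "\<lambda>f t. vector_derivative f (at t within {0..T})"
    have 1: "(SUP t\<in>{0..T}. norm (c *\<^sub>R x t)) \<le> \<bar>c\<bar> * (SUP t\<in>{0..T}. norm (x t))"
      using ne by (intro cSUP_least) (auto intro!: mult_left_mono cSUP_upper X(4))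
    have "?d (\<lambda>t. c *\<^sub>R x t) t = c *\<^sub>R ?d x t" if "t \<in> {0..T}" for t
      using that by (intro vderiv_C1_00_unique assms(1) X(1)
          bounded_linear.has_vector_derivative[OF bounded_linear_scaleR_right])
    then have 2: "(SUP t\<in>{0..T}. norm (?d (\<lambda>t. c *\<^sub>R x t) t)) \<le> \<bar>c\<bar> * (SUP t\<in>{0..T}. norm (?d x t))"
      using ne by (intro cSUP_least) (auto intro!: mult_left_mono cSUP_upper X(5))
    show ?thesis using 1 2 by (simp add: C1_norm_def distrib_left)
  qed
  show ?thesis
  proof (cases "c = 0")
    case True
    then show ?thesis
      using C1_norm_eq_0_iff[OF assms(1) C1_00_zero] by simp
  next
    case False
    have "C1_norm T x \<le> \<bar>inverse c\<bar> * C1_norm T (\<lambda>t. c *\<^sub>R x t)"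
      using le[OF C1_00_scaleR[OF assms(2), of c], of "inverse c"] False by simp
    then have "\<bar>c\<bar> * C1_norm T x \<le> C1_norm T (\<lambda>t. c *\<^sub>R x t)"
      using False by (simp add: field_simps)
    then show ?thesis using le[OF assms(2), of c] by simp
  qed
qed

lemma Metric_space_C1:
  assumes "T > 0"
  shows "Metric_space (C1_00 T :: (real \<Rightarrow> real ^ 'n) set) (C1_dist T)"
proof
  have comm: "C1_norm T (\<lambda>t. x t - y t) = C1_norm T (\<lambda>t. y t - x t)"
    if "x \<in> C1_00 T" "y \<in> C1_00 T" for x y :: "real \<Rightarrow> real ^ 'n"
    using C1_norm_scaleR[OF assms C1_00_diff[OF that], of "-1"] by simp
  show "0 \<le> C1_dist T x y" for x y :: "real \<Rightarrow> real ^ 'n"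
    using C1_norm_bounds(1)[OF assms C1_00_diff] by (auto simp: C1_dist_def)
  show "C1_dist T x y = C1_dist T y x" for x y :: "real \<Rightarrow> real ^ 'n"
    using comm by (auto simp: C1_dist_def)
  show "C1_dist T x y = 0 \<longleftrightarrow> x = y" if "x \<in> C1_00 T" "y \<in> C1_00 T" for x y :: "real \<Rightarrow> real ^ 'n"
    using C1_norm_eq_0_iff[OF assms C1_00_diff[OF that]] that by (auto simp: C1_dist_def fun_eq_iff)
  show "C1_dist T x z \<le> C1_dist T x y + C1_dist T y z"
    if "x \<in> C1_00 T" "y \<in> C1_00 T" "z \<in> C1_00 T" for x y z :: "real \<Rightarrow> real ^ 'n"
    using C1_norm_add[OF assms C1_00_diff[OF that(1,2)] C1_00_diff[OF that(2,3)]] that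
    by (simp add: C1_dist_def)
qed

lemma C1_dual_bounded:
  fixes L :: "(real \<Rightarrow> real ^ 'n) \<Rightarrow> real"
  assumes "T > 0" "L \<in> C1_dual T"
  obtains K where "K \<ge> 0" "\<And>x. x \<in> C1_00 T \<Longrightarrow> \<bar>L x\<bar> \<le> K * C1_norm T x"
proof -
  interpret Metric_space "C1_00 T :: (real \<Rightarrow> real ^ 'n) set" "C1_dist T"
    by (rule Metric_space_C1[OF assms(1)])
  have scale: "L (\<lambda>t. c *\<^sub>R x t) = c * L x" if "x \<in> C1_00 T" for c x
    using assms(2) that by (auto simp: C1_dual_def)
  have L0: "L (\<lambda>t. 0) = 0"
    using scale[OF C1_00_zero, of 0] by simp
  have "continuous_map mtopology euclideanreal L"
    using assms(2) by (simp add: C1_dual_def C1_topology_def)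
  then have "continuous_map mtopology Met_TC.mtopology L"
    by simp
  then obtain \<delta> where \<delta>: "\<delta> > 0"
    and "\<And>x. x \<in> C1_00 T \<and> C1_dist T (\<lambda>t. 0) x < \<delta> \<Longrightarrow> dist (L (\<lambda>t. 0)) (L x) < 1"
    using C1_00_zero metric_continuous_map[OF Met_TC.Metric_space_axioms, of L]
    by (metis zero_less_one)
  then have \<delta>1: "\<bar>L x\<bar> < 1" if "x \<in> C1_00 T" "C1_norm T x < \<delta>" for x
    using that C1_norm_scaleR[OF assms(1) that(1), of "-1"] C1_00_zero L0
    by (auto simp: C1_dist_def dist_real_def)
  have "\<bar>L x\<bar> \<le> (2 / \<delta>) * C1_norm T x" if x: "x \<in> C1_00 T" for x
  proof (cases "C1_norm T x = 0")
    case True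
    then show ?thesis using C1_norm_eq_0_iff[OF assms(1) x] L0 by simp
  next
    case False
    then have pos: "C1_norm T x > 0"
      using C1_norm_bounds(1)[OF assms(1) x] by simp
    define c where "c = \<delta> / (2 * C1_norm T x)"
    have c: "c > 0" using \<delta> pos by (simp add: c_def)
    have "C1_norm T (\<lambda>t. c *\<^sub>R x t) < \<delta>"
      using C1_norm_scaleR[OF assms(1) x, of c] c pos \<delta> by (simp add: c_def)
    then have "c * \<bar>L x\<bar> < 1"
      using \<delta>1[OF C1_00_scaleR[OF x, of c]] scale[OF x] c by (simp add: abs_mult)
    then show ?thesis using pos \<delta> by (simp add: c_def field_simps)
  qed
  with that[of "2 / \<delta>"] \<delta> show ?thesis by simp
qed

lemma C1_dual_diff_bounded:
  fixes L M :: "(real \<Rightarrow> real ^ 'n) \<Rightarrow> real"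
  assumes "T > 0" "L \<in> C1_dual T" "M \<in> C1_dual T"
  shows "bdd_above ((\<lambda>x. \<bar>L x - M x\<bar>) ` {x \<in> C1_00 T. C1_norm T x \<le> 1})"
proof -
  obtain K where K: "K \<ge> 0" "\<And>x. x \<in> C1_00 T \<Longrightarrow> \<bar>L x\<bar> \<le> K * C1_norm T x"
    using C1_dual_bounded[OF assms(1,2)] by blast
  obtain K' where K': "K' \<ge> 0" "\<And>x. x \<in> C1_00 T \<Longrightarrow> \<bar>M x\<bar> \<le> K' * C1_norm T x"
    using C1_dual_bounded[OF assms(1,3)] by blast
  have "\<bar>L x - M x\<bar> \<le> K + K'" if "x \<in> C1_00 T" "C1_norm T x \<le> 1" for x
    using K(2)[OF that(1)] K'(2)[OF that(1)] mult_left_mono[OF that(2) K(1)]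
      mult_left_mono[OF that(2) K'(1)] by linarith
  then show ?thesis by (intro bdd_aboveI2[where M = "K + K'"]) auto
qed

lemma Metric_space_dual:
  assumes "T > 0"
  shows "Metric_space (C1_dual T :: ((real \<Rightarrow> real ^ 'n) \<Rightarrow> real) set) (dual_dist T)"
proof
  let ?B = "{x :: real \<Rightarrow> real ^ 'n. x \<in> C1_00 T \<and> C1_norm T x \<le> 1}"
  have zB: "(\<lambda>t. 0) \<in> ?B"
    by (simp add: C1_00_zero C1_norm_eq_0_iff[OF assms C1_00_zero, THEN iffD2, OF refl])
  have eq: "dual_dist T L M = (SUP x\<in>?B. \<bar>L x - M x\<bar>)" if "L \<in> C1_dual T" "M \<in> C1_dual T" for L M
    using that by (simp add: dual_dist_def dual_norm_def)
  have up: "\<bar>L x - M x\<bar> \<le> dual_dist T L M"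
    if "L \<in> C1_dual T" "M \<in> C1_dual T" "x \<in> ?B" for L M x
    unfolding eq[OF that(1,2)] by (rule cSUP_upper[OF that(3) C1_dual_diff_bounded[OF assms that(1,2)]])
  show "0 \<le> dual_dist T L M" for L M :: "(real \<Rightarrow> real ^ 'n) \<Rightarrow> real"
  proof (cases "L \<in> C1_dual T \<and> M \<in> C1_dual T")
    case True
    then show ?thesis using order_trans[OF abs_ge_zero up[OF _ _ zB, of L M]] by blast
  qed (auto simp: dual_dist_def)
  show "dual_dist T L M = dual_dist T M L" for L M :: "(real \<Rightarrow> real ^ 'n) \<Rightarrow> real"
    by (auto simp: dual_dist_def dual_norm_def abs_minus_commute)
  show "dual_dist T L M = 0 \<longleftrightarrow> L = M" if LM: "L \<in> C1_dual T" "M \<in> C1_dual T"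
    for L M :: "(real \<Rightarrow> real ^ 'n) \<Rightarrow> real"
  proof
    assume 0: "dual_dist T L M = 0"
    have "L x = M x" for x
    proof (cases "x \<in> C1_00 T")
      case x: True
      define c where "c = inverse (1 + C1_norm T x)"
      have nn: "C1_norm T x \<ge> 0" by (rule C1_norm_bounds(1)[OF assms x])
      then have c: "c > 0" by (simp add: c_def)
      have "c * C1_norm T x \<le> 1" using nn by (simp add: c_def field_simps)
      then have "(\<lambda>t. c *\<^sub>R x t) \<in> ?B"
        using C1_00_scaleR[OF x, of c] C1_norm_scaleR[OF assms x, of c] c by simp
      from up[OF LM this] have "L (\<lambda>t. c *\<^sub>R x t) = M (\<lambda>t. c *\<^sub>R x t)"
        unfolding 0 by linarith
      moreover have "L (\<lambda>t. c *\<^sub>R x t) = c * L x" "M (\<lambda>t. c *\<^sub>R x t) = c * M x"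
        using LM x by (simp_all add: C1_dual_def)
      ultimately show ?thesis using c by simp
    next
      case False
      then show ?thesis using LM by (simp add: C1_dual_def)
    qed
    then show "L = M" by blast
  next
    assume "L = M"
    then have "dual_dist T L M = (SUP x\<in>?B. (0::real))"
      unfolding eq[OF LM] by (simp only: diff_self abs_zero)
    also have "\<dots> = 0"
      by (rule cSUP_const) (use zB in blast)
    finally show "dual_dist T L M = 0" .
  qed
  show "dual_dist T L N \<le> dual_dist T L M + dual_dist T M N"
    if "L \<in> C1_dual T" "M \<in> C1_dual T" "N \<in> C1_dual T" for L M N :: "(real \<Rightarrow> real ^ 'n) \<Rightarrow> real"
  proof -
    have "\<bar>L x - N x\<bar> \<le> dual_dist T L M + dual_dist T M N" if "x \<in> ?B" for x
      using up[OF \<open>L \<in> C1_dual T\<close> \<open>M \<in> C1_dual T\<close> that] up[OF \<open>M \<in> C1_dual T\<close> \<open>N \<in> C1_dual T\<close> that]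
      by linarith
    moreover have "?B \<noteq> {}" using zB by blast
    ultimately show ?thesis
      unfolding eq[OF that(1,3)] by (intro cSUP_least)
  qed
qed

end

theory Submission
  imports Defs
begin

text \<open>
  The functions \<open>t \<mapsto> (t\<^sup>k\<^sup>+\<^sup>1 - T\<^sup>k t) e\<^sub>i\<close> form a countable family whose span is dense in
  \<^term>\<open>C1_00 T\<close>: approximate \<open>x'\<close> uniformly by a polynomial \<open>p\<close>, integrate \<open>p\<close>, and subtract the
  linear function that restores the boundary value at \<open>T\<close>, which is small because
  \<open>\<integral>\<^sub>0\<^sup>T x' = 0\<close>. Hence a functional vanishing on the family is zero. Normalising the family to a
  sequence \<open>\<psi>\<^sub>k\<close> in the unit ball, \<open>B L M = (\<Sum>k. L \<psi>\<^sub>k * M \<psi>\<^sub>k / 2\<^sup>k)\<close> is an inner product, continuous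
  because \<open>\<bar>L \<psi>\<^sub>k\<bar>\<close> is at most the dual norm of \<open>L\<close>.
\<close>

section \<open>A countable family separating the dual\<close>

text \<open>Mean value inequality: the derivative, read as the linear map
  \<open>h \<mapsto> h *\<^sub>R f' u\<close>, has operator norm at most \<open>e\<close>.
  Derivatives within \<open>S\<close> cover the one-sided ones at the ends of the interval.\<close>

lemma norm_diff_le_vector_derivative_bound:
  fixes f :: "real \<Rightarrow> 'a::real_normed_vector"
  assumes "convex S"
    and "\<And>t. t \<in> S \<Longrightarrow> (f has_vector_derivative f' t) (at t within S)"
    and "\<And>t. t \<in> S \<Longrightarrow> norm (f' t) \<le> e"
    and "s \<in> S" "t \<in> S"
  shows "norm (f t - f s) \<le> e * \<bar>t - s\<bar>"
proof -
  have "norm (f t - f s) \<le> e * norm (t - s)"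
  proof (rule differentiable_bound[OF assms(1) _ _ assms(5,4)])
    show "(f has_derivative (\<lambda>h. h *\<^sub>R f' u)) (at u within S)" if "u \<in> S" for u
      using assms(2)[OF that] by (simp add: has_vector_derivative_def)
    show "onorm (\<lambda>h. h *\<^sub>R f' u) \<le> e" if "u \<in> S" for u
    proof (rule onorm_le)
      show "norm (h *\<^sub>R f' u) \<le> e * norm h" for h
        using mult_right_mono[OF assms(3)[OF that], of "norm h"] by (simp add: mult.commute)
    qed
  qed
  then show ?thesis by simp
qed

text \<open>Since \<open>x 0 = 0\<close>, the mean value inequality bounds the values of
  \<open>x\<close> by \<open>T * e\<close>. Approximation in the C1 norm thus reduces to uniform
  approximation of derivatives.\<close>

lemma C1_norm_le_derivative_bound:
  fixes x :: "real \<Rightarrow> real ^ 'n"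
  assumes T: "T > 0" and x: "x \<in> C1_00 T"
    and der: "\<And>t. t \<in> {0..T} \<Longrightarrow> (x has_vector_derivative x' t) (at t within {0..T})"
    and le: "\<And>t. t \<in> {0..T} \<Longrightarrow> norm (x' t) \<le> e"
  shows "C1_norm T x \<le> (T + 1) * e"
proof -
  have ne: "{0..T} \<noteq> {}" and T0: "0 \<in> {0..T}" using T by auto
  have e: "e \<ge> 0" using le[OF T0] norm_ge_zero order_trans by blast
  have "norm (x t) \<le> T * e" if t: "t \<in> {0..T}" for t
  proof -
    have "norm (x t - x 0) \<le> e * \<bar>t - 0\<bar>"
      by (rule norm_diff_le_vector_derivative_bound[OF convex_real_interval(5) der le T0 t])
    also have "\<dots> \<le> e * T" using t e by (intro mult_left_mono) auto
    finally show ?thesis using x by (simp add: C1_00_def mult.commute)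
  qed
  then have "(SUP t\<in>{0..T}. norm (x t)) \<le> T * e" using ne by (intro cSUP_least)
  moreover have "(SUP t\<in>{0..T}. norm (vector_derivative x (at t within {0..T}))) \<le> e"
    using ne le vderiv_C1_00_unique[OF T _ der] by (intro cSUP_least) auto
  ultimately show ?thesis by (simp add: C1_norm_def algebra_simps)
qed

section \<open>Finite linear combinations\<close>

lemma C1_00_sum:
  fixes \<phi> :: "'j \<Rightarrow> real \<Rightarrow> real ^ 'n"
  assumes "finite J" "\<And>j. j \<in> J \<Longrightarrow> \<phi> j \<in> C1_00 T"
  shows "(\<lambda>t. \<Sum>j\<in>J. c j *\<^sub>R \<phi> j t) \<in> C1_00 T"
  using assms by (induction J) (simp_all add: C1_00_zero C1_00_add C1_00_scaleR)

lemma C1_dual_add: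
  assumes "L \<in> C1_dual T" "x \<in> C1_00 T" "y \<in> C1_00 T"
  shows "L (\<lambda>t. x t + y t) = L x + L y"
  using assms by (simp add: C1_dual_def)

lemma C1_dual_scaleR:
  assumes "L \<in> C1_dual T" "x \<in> C1_00 T"
  shows "L (\<lambda>t. c *\<^sub>R x t) = c * L x"
  using assms by (simp add: C1_dual_def)

lemma C1_dual_sum:
  fixes \<phi> :: "'j \<Rightarrow> real \<Rightarrow> real ^ 'n"
  assumes L: "L \<in> C1_dual T" and "finite J" "\<And>j. j \<in> J \<Longrightarrow> \<phi> j \<in> C1_00 T"
  shows "L (\<lambda>t. \<Sum>j\<in>J. c j *\<^sub>R \<phi> j t) = (\<Sum>j\<in>J. c j * L (\<phi> j))"
  using assms(2,3)
proof (induction J)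
  case empty
  then show ?case using C1_dual_scaleR[OF L C1_00_zero, of 0] by simp
next
  case (insert j J)
  then have "L (\<lambda>t. c j *\<^sub>R \<phi> j t + (\<Sum>j\<in>J. c j *\<^sub>R \<phi> j t))
      = L (\<lambda>t. c j *\<^sub>R \<phi> j t) + L (\<lambda>t. \<Sum>j\<in>J. c j *\<^sub>R \<phi> j t)"
    by (intro C1_dual_add[OF L] C1_00_scaleR C1_00_sum) auto
  with insert show ?case by (simp add: C1_dual_scaleR[OF L])
qed

text \<open>Each coordinate is a real polynomial with its own degree bound \<open>N i\<close>;
  flattening the double sum yields the index pairs that also index
  \<open>C1_00_monomial\<close>.\<close>

lemma polynomial_function_vec_sum:
  fixes p :: "real \<Rightarrow> real ^ 'n"
  assumes "polynomial_function p"
  obtains J :: "('n \<times> nat) set" and a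
    where "finite J" "\<And>t. p t = (\<Sum>(i, k)\<in>J. (a (i, k) * t ^ k) *\<^sub>R axis i 1)"
proof -
  have "\<exists>a N. (\<lambda>t. p t $ i) = (\<lambda>t. \<Sum>k\<le>N. a k * t ^ k)" for i
  proof -
    have "real_polynomial_function (\<lambda>t. p t \<bullet> axis i 1)"
      using assms polynomial_function_iff_Basis_inner axis_in_Basis_iff by fastforce
    then show ?thesis
      using real_polynomial_function_iff_sum by (simp add: inner_axis)
  qed
  then obtain a N where aN: "\<And>i. (\<lambda>t. p t $ i) = (\<lambda>t. \<Sum>k\<le>N i. a i k * t ^ k)"
    by metis
  let ?J = "SIGMA i:UNIV. {..N i}"
  have "p t = (\<Sum>(i, k)\<in>?J. (a i k * t ^ k) *\<^sub>R axis i 1)" for t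
  proof -
    have "p t = (\<Sum>i\<in>UNIV. (p t $ i) *\<^sub>R axis i 1)"
      using basis_expansion[of "p t"] by (simp add: scalar_mult_eq_scaleR)
    also have "\<dots> = (\<Sum>i\<in>UNIV. \<Sum>k\<le>N i. (a i k * t ^ k) *\<^sub>R axis i 1)"
      using aN[THEN fun_cong] by (simp add: scaleR_left.sum)
    also have "\<dots> = (\<Sum>(i, k)\<in>?J. (a i k * t ^ k) *\<^sub>R axis i 1)"
      by (rule sum.Sigma) auto
    finally show ?thesis .
  qed
  then show thesis
    by (intro that[of ?J "\<lambda>(i, k). a i k"]) auto
qed

text \<open>The power \<open>t ^ Suc k\<close> is an antiderivative of \<open>t ^ k\<close> up to a
  factor, and the linear term restores the value 0 at \<open>T\<close>. For \<open>k = 0\<close> the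
  result is the zero function, which is harmless.\<close>

definition C1_00_monomial :: "real \<Rightarrow> 'n \<times> nat \<Rightarrow> real \<Rightarrow> real ^ 'n" where
  "C1_00_monomial T = (\<lambda>(i, k) t.
     if t \<in> {0..T} then (t ^ Suc k - T ^ k * t) *\<^sub>R axis i 1 else 0)"

lemma C1_00_monomial_in_C1_00:
  assumes "T > 0"
  shows "C1_00_monomial T j \<in> C1_00 T"
proof -
  obtain i k where j: "j = (i, k)" by fastforce
  have "(C1_00_monomial T j has_vector_derivative (real (Suc k) * t ^ k - T ^ k) *\<^sub>R axis i 1)
      (at t within {0..T})" if "t \<in> {0..T}" for t
  proof (rule has_vector_derivative_transform[OF that])
    show "((\<lambda>t. (t ^ Suc k - T ^ k * t) *\<^sub>R axis i 1) has_vector_derivative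
        (real (Suc k) * t ^ k - T ^ k) *\<^sub>R axis i 1) (at t within {0..T})"
      by (rule derivative_eq_intros refl | simp)+
  qed (simp add: j C1_00_monomial_def)
  moreover have "continuous_on {0..T} (\<lambda>t. (real (Suc k) * t ^ k - T ^ k) *\<^sub>R axis i (1::real))"
    by (intro continuous_intros)
  ultimately show ?thesis
    unfolding C1_00_def by (auto simp: j C1_00_monomial_def)
qed

text \<open>The error in the derivative has two parts, each at most \<open>e\<close>: the uniform
  error of the polynomial \<open>p\<close> and the slope of the linear correction. The factor
  \<open>T + 1\<close> comes from \<open>C1_norm_le_derivative_bound\<close>.\<close>

lemma C1_dense_span_monomials:
  fixes x :: "real \<Rightarrow> real ^ 'n"
  assumes T: "T > 0" and x: "x \<in> C1_00 T" and e: "e > 0"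
  obtains J :: "('n \<times> nat) set" and c where "finite J"
    "C1_norm T (\<lambda>t. x t - (\<Sum>j\<in>J. c j *\<^sub>R C1_00_monomial T j t)) \<le> (T + 1) * (2 * e)"
proof -
  obtain x' where x'c: "continuous_on {0..T} x'"
    and x': "\<And>t. t \<in> {0..T} \<Longrightarrow> (x has_vector_derivative x' t) (at t within {0..T})"
    using x by (auto simp: C1_00_def)
  obtain p where p: "polynomial_function p" and xp: "\<And>t. t \<in> {0..T} \<Longrightarrow> norm (x' t - p t) < e"
    using Stone_Weierstrass_polynomial_function[OF compact_Icc x'c e] by blast
  obtain J :: "('n \<times> nat) set" and a where J: "finite J"
    and pJ: "\<And>t. p t = (\<Sum>(i, k)\<in>J. (a (i, k) * t ^ k) *\<^sub>R axis i 1)"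
    using polynomial_function_vec_sum[OF p] by blast
  \<comment> \<open>Dividing by \<open>k + 1\<close> makes \<open>P\<close> the antiderivative of
    \<open>p\<close> that vanishes at 0.\<close>
  define c where "c j = a j / real (Suc (snd j))" for j
  define P where "P t = (\<Sum>(i, k)\<in>J. (c (i, k) * t ^ Suc k) *\<^sub>R axis i (1::real))" for t
  have P: "(P has_vector_derivative p t) (at t within {0..T})" for t
  proof -
    have "((\<lambda>t. (c (i, k) * t ^ Suc k) *\<^sub>R axis i (1::real)) has_vector_derivative
        (a (i, k) * t ^ k) *\<^sub>R axis i 1) (at t within {0..T})" for i k
      by (rule derivative_eq_intros refl | simp add: c_def)+
    then show ?thesis
      unfolding P_def[abs_def] pJ split_beta by (intro has_vector_derivative_sum) auto
  qed
  have P0: "P 0 = 0" by (simp add: P_def split_beta)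
  define q where "q t = (\<Sum>j\<in>J. c j *\<^sub>R C1_00_monomial T j t)" for t
  \<comment> \<open>The corrections add up to one linear function because
    \<open>T ^ k * t = (t / T) * T ^ Suc k\<close>.\<close>
  have q: "q t = P t - (t / T) *\<^sub>R P T" if "t \<in> {0..T}" for t
    using that T unfolding q_def P_def C1_00_monomial_def scaleR_sum_right sum_subtractf[symmetric]
    by (intro sum.cong) (auto simp: algebra_simps)
  \<comment> \<open>The difference \<open>x - P\<close> starts at 0, ends at \<open>- P T\<close>,
    and has derivative \<open>x' - p\<close> of norm below \<open>e\<close>.\<close>
  have PT: "norm (P T) \<le> e * T"
  proof -
    have "norm ((x T - P T) - (x 0 - P 0)) \<le> e * \<bar>T - 0\<bar>"
      using T by (intro norm_diff_le_vector_derivative_bound[where S = "{0..T}"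
            and f' = "\<lambda>t. x' t - p t"] has_vector_derivative_diff x' P less_imp_le[OF xp]) auto
    then show ?thesis using x T P0 by (simp add: C1_00_def)
  qed
  have qC: "q \<in> C1_00 T"
    unfolding q_def[abs_def] by (intro C1_00_sum J C1_00_monomial_in_C1_00 T)
  have "C1_norm T (\<lambda>t. x t - q t) \<le> (T + 1) * (2 * e)"
  proof (rule C1_norm_le_derivative_bound[OF T C1_00_diff[OF x qC]])
    show "((\<lambda>t. x t - q t) has_vector_derivative x' t - (p t - (1 / T) *\<^sub>R P T))
        (at t within {0..T})" if t: "t \<in> {0..T}" for t
    proof (rule has_vector_derivative_transform[OF t])
      show "((\<lambda>t. x t - (P t - (t / T) *\<^sub>R P T)) has_vector_derivative
          x' t - (p t - (1 / T) *\<^sub>R P T)) (at t within {0..T})"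
        using T by (intro has_vector_derivative_diff x'[OF t] P)
          (rule derivative_eq_intros refl | simp)+
    qed (simp add: q)
    show "norm (x' t - (p t - (1 / T) *\<^sub>R P T)) \<le> 2 * e" if t: "t \<in> {0..T}" for t
    proof -
      have "norm ((1 / T) *\<^sub>R P T) \<le> e" using PT T by (simp add: field_simps)
      then show ?thesis
        using xp[OF t] norm_triangle_ineq[of "x' t - p t" "(1 / T) *\<^sub>R P T"]
        by (simp add: algebra_simps)
    qed
  qed
  with J show thesis unfolding q_def by (rule that)
qed

text \<open>By linearity \<open>L\<close> vanishes on the span of the monomials, so
  \<open>L x = L (x - q)\<close> for each approximant \<open>q\<close>; boundedness of
  \<open>L\<close> makes this arbitrarily small.\<close>

lemma C1_dual_eq_0I:
  fixes L :: "(real \<Rightarrow> real ^ 'n) \<Rightarrow> real"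
  assumes T: "T > 0" and L: "L \<in> C1_dual T"
    and zero: "\<And>j. L (C1_00_monomial T j) = 0"
  shows "L = (\<lambda>x. 0)"
proof
  fix x
  show "L x = 0"
  proof (cases "x \<in> C1_00 T")
    case x: True
    obtain K where K: "K \<ge> 0" "\<And>x. x \<in> C1_00 T \<Longrightarrow> \<bar>L x\<bar> \<le> K * C1_norm T x"
      using C1_dual_bounded[OF T L] by blast
    have bound: "\<bar>L x\<bar> \<le> K * ((T + 1) * (2 * e))" if e: "e > 0" for e
    proof -
      obtain J :: "('n \<times> nat) set" and c where J: "finite J" and
        le: "C1_norm T (\<lambda>t. x t - (\<Sum>j\<in>J. c j *\<^sub>R C1_00_monomial T j t)) \<le> (T + 1) * (2 * e)"
        using C1_dense_span_monomials[OF T x e] by blast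
      define q where "q t = (\<Sum>j\<in>J. c j *\<^sub>R C1_00_monomial T j t)" for t
      have q: "q \<in> C1_00 T" "L q = 0"
        using J by (simp_all add: q_def[abs_def] C1_00_sum C1_00_monomial_in_C1_00 T
            C1_dual_sum[OF L] zero)
      have xq: "(\<lambda>t. x t - q t) \<in> C1_00 T" by (rule C1_00_diff[OF x q(1)])
      have "L x = L (\<lambda>t. x t - q t)"
        using C1_dual_add[OF L xq q(1)] q(2) by simp
      also have "\<bar>\<dots>\<bar> \<le> K * C1_norm T (\<lambda>t. x t - q t)" by (rule K(2)[OF xq])
      also have "\<dots> \<le> K * ((T + 1) * (2 * e))"
        using le K(1) unfolding q_def by (rule mult_left_mono)
      finally show ?thesis .
    qed
    have "((\<lambda>e. K * ((T + 1) * (2 * e))) \<longlongrightarrow> K * ((T + 1) * (2 * 0))) (at_right 0)"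
      by (intro tendsto_intros)
    moreover have "\<forall>\<^sub>F e in at_right 0. \<bar>L x\<bar> \<le> K * ((T + 1) * (2 * e))"
      using eventually_at_right_less by eventually_elim (rule bound)
    ultimately have "\<bar>L x\<bar> \<le> K * ((T + 1) * (2 * 0))"
      by (rule tendsto_lowerbound) simp
    then show ?thesis by simp
  \<comment> \<open>Outside \<open>C1_00 T\<close> the value is 0 by the encoding of
    functionals.\<close>
  qed (use L in \<open>simp add: C1_dual_def\<close>)
qed

lemma separating_sequence_in_unit_ball:
  assumes T: "T > 0"
  obtains \<psi> :: "nat \<Rightarrow> real \<Rightarrow> real ^ 'n"
    where "\<And>k. \<psi> k \<in> C1_00 T" "\<And>k. C1_norm T (\<psi> k) \<le> 1"
      "\<And>L. L \<in> C1_dual T \<Longrightarrow> (\<And>k. L (\<psi> k) = 0) \<Longrightarrow> L = (\<lambda>x. 0)"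
proof -
  define \<phi> :: "nat \<Rightarrow> real \<Rightarrow> real ^ 'n" where "\<phi> k = C1_00_monomial T (from_nat k)" for k
  \<comment> \<open>Adding 1 keeps the factor positive and well defined even where
    \<open>\<phi> k\<close> is the zero function.\<close>
  define r where "r k = inverse (1 + C1_norm T (\<phi> k))" for k
  have \<phi>: "\<phi> k \<in> C1_00 T" for k by (simp add: \<phi>_def C1_00_monomial_in_C1_00 T)
  have nn: "C1_norm T (\<phi> k) \<ge> 0" for k by (rule C1_norm_bounds(1)[OF T \<phi>])
  have r: "r k > 0" for k using nn[of k] by (simp add: r_def)
  show thesis
  proof
    show "(\<lambda>t. r k *\<^sub>R \<phi> k t) \<in> C1_00 T" for k by (rule C1_00_scaleR[OF \<phi>])
    show "C1_norm T (\<lambda>t. r k *\<^sub>R \<phi> k t) \<le> 1" for k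
      using nn[of k] r[of k] by (simp add: C1_norm_scaleR[OF T \<phi>]) (simp add: r_def field_simps)
    show "L = (\<lambda>x. 0)" if L: "L \<in> C1_dual T" and 0: "\<And>k. L (\<lambda>t. r k *\<^sub>R \<phi> k t) = 0" for L
    proof (rule C1_dual_eq_0I[OF T L])
      fix j :: "'n \<times> nat"
      have "L (\<phi> k) = 0" for k
        using 0[of k] r[of k] by (simp add: C1_dual_scaleR[OF L \<phi>])
      from this[of "to_nat j"] show "L (C1_00_monomial T j) = 0" by (simp add: \<phi>_def)
    qed
  qed
qed

section \<open>The inner product\<close>

lemma zero_in_C1_dual: "(\<lambda>x. 0) \<in> C1_dual T"
  by (simp add: C1_dual_def)

text \<open>Evaluation at a point of the unit ball is 1-Lipschitz for the dual metric, with a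
  constant independent of the point. This uniformity controls all terms of the series at
  once.\<close>

lemma C1_dual_diff_le_dist:
  fixes L M :: "(real \<Rightarrow> real ^ 'n) \<Rightarrow> real"
  assumes "T > 0" "L \<in> C1_dual T" "M \<in> C1_dual T" "x \<in> C1_00 T" "C1_norm T x \<le> 1"
  shows "\<bar>L x - M x\<bar> \<le> dual_dist T L M"
  using cSUP_upper[OF _ C1_dual_diff_bounded[OF assms(1-3)], of x] assms(2-)
  by (simp add: dual_dist_def dual_norm_def)

text \<open>The pullback of a weighted l2 inner product along
  \<open>f \<mapsto> (\<lambda>k. f (\<psi> k))\<close>. Geometric weights make it converge whenever
  both sequences of values are bounded.\<close>

definition weighted_form :: "(nat \<Rightarrow> 'a) \<Rightarrow> ('a \<Rightarrow> real) \<Rightarrow> ('a \<Rightarrow> real) \<Rightarrow> real" where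
  "weighted_form \<psi> f g = (\<Sum>k. (1/2) ^ k * (f (\<psi> k) * g (\<psi> k)))"

lemma summable_geometric_mult_bounded:
  fixes u :: "nat \<Rightarrow> real"
  assumes "\<And>k. \<bar>u k\<bar> \<le> C"
  shows "summable (\<lambda>k. (1/2) ^ k * u k)"
proof (rule summable_comparison_test')
  show "summable (\<lambda>k. C * (1/2) ^ k)" by (intro summable_mult summable_geometric) simp
  show "norm ((1/2) ^ k * u k) \<le> C * (1/2) ^ k" for k
    using assms[of k] by (simp add: abs_mult mult.commute)
qed

section \<open>The form on functions bounded along a sequence\<close>

context
  fixes V :: "('a \<Rightarrow> real) set" and \<psi> :: "nat \<Rightarrow> 'a"
  assumes bdd: "\<And>f. f \<in> V \<Longrightarrow> \<exists>C. \<forall>k. \<bar>f (\<psi> k)\<bar> \<le> C"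
begin

lemma summable_weighted_form:
  assumes "f \<in> V" "g \<in> V"
  shows "summable (\<lambda>k. (1/2) ^ k * (f (\<psi> k) * g (\<psi> k)))"
proof -
  obtain C D where C: "\<And>k. \<bar>f (\<psi> k)\<bar> \<le> C" and D: "\<And>k. \<bar>g (\<psi> k)\<bar> \<le> D"
    using bdd assms by meson
  have "\<bar>f (\<psi> k) * g (\<psi> k)\<bar> \<le> C * D" for k
    unfolding abs_mult using C[of k] D[of k] by (intro mult_mono) auto
  then show ?thesis by (rule summable_geometric_mult_bounded)
qed

text \<open>Separation enters only through definiteness: a vanishing sum of nonnegative terms forces
  every \<open>f (\<psi> k)\<close> to be 0.\<close>

lemma inner_product_on_weighted_form:
  assumes sep: "\<And>f. f \<in> V \<Longrightarrow> (\<And>k. f (\<psi> k) = 0) \<Longrightarrow> f = (\<lambda>x. 0)"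
  shows "inner_product_on V (weighted_form \<psi>)"
  unfolding inner_product_on_def
proof (intro conjI ballI allI)
  fix f g h and c :: real
  assume f: "f \<in> V"
  show "weighted_form \<psi> f g = weighted_form \<psi> g f"
    by (simp add: weighted_form_def mult.commute)
  show "0 \<le> weighted_form \<psi> f f"
    unfolding weighted_form_def using summable_weighted_form[OF f f] by (intro suminf_nonneg) auto
  show "weighted_form \<psi> f f = 0 \<longleftrightarrow> f = (\<lambda>x. 0)"
  proof
    assume "weighted_form \<psi> f f = 0"
    then have "f (\<psi> k) = 0" for k
      using suminf_eq_zero_iff[OF summable_weighted_form[OF f f]] by (simp add: weighted_form_def)
    then show "f = (\<lambda>x. 0)" by (rule sep[OF f])
  qed (simp add: weighted_form_def)
  assume g: "g \<in> V"
  show "weighted_form \<psi> (\<lambda>x. c * f x) g = c * weighted_form \<psi> f g"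
    using suminf_mult[OF summable_weighted_form[OF f g], of c]
    by (simp add: weighted_form_def mult_ac)
  assume h: "h \<in> V"
  show "weighted_form \<psi> (\<lambda>x. f x + g x) h = weighted_form \<psi> f h + weighted_form \<psi> g h"
    using suminf_add[OF summable_weighted_form[OF f h] summable_weighted_form[OF g h]]
    by (simp add: weighted_form_def algebra_simps)
qed

text \<open>The usual splitting of a difference of products, applied termwise; the factor 2 is the
  sum of the weights. With \<open>C\<close> and \<open>D\<close> fixed, the bound tends to 0 with
  \<open>a\<close> and \<open>b\<close>, which gives joint continuity.\<close>

lemma weighted_form_diff_le:
  assumes V: "f \<in> V" "g \<in> V" "f' \<in> V" "g' \<in> V"
    and le: "\<And>k. \<bar>f (\<psi> k) - f' (\<psi> k)\<bar> \<le> a" "\<And>k. \<bar>g (\<psi> k) - g' (\<psi> k)\<bar> \<le> b"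
      "\<And>k. \<bar>f' (\<psi> k)\<bar> \<le> C" "\<And>k. \<bar>g' (\<psi> k)\<bar> \<le> D"
  shows "\<bar>weighted_form \<psi> f g - weighted_form \<psi> f' g'\<bar> \<le> 2 * (a * (b + D) + C * b)"
proof -
  let ?R = "a * (b + D) + C * b"
  let ?u = "\<lambda>k. f (\<psi> k) * g (\<psi> k) - f' (\<psi> k) * g' (\<psi> k)"
  have u: "\<bar>?u k\<bar> \<le> ?R" for k
  proof -
    have "?u k = (f (\<psi> k) - f' (\<psi> k)) * g (\<psi> k) + f' (\<psi> k) * (g (\<psi> k) - g' (\<psi> k))"
      by (simp add: algebra_simps)
    also have "\<bar>\<dots>\<bar> \<le> \<bar>f (\<psi> k) - f' (\<psi> k)\<bar> * \<bar>g (\<psi> k)\<bar> + \<bar>f' (\<psi> k)\<bar> * \<bar>g (\<psi> k) - g' (\<psi> k)\<bar>"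
      using abs_triangle_ineq by (simp add: abs_mult[symmetric])
    \<comment> \<open>Here \<open>\<bar>g (\<psi> k)\<bar>\<close> is at most \<open>b + D\<close>
      by the triangle inequality through \<open>g' (\<psi> k)\<close>.\<close>
    also have "\<dots> \<le> ?R"
      using le[of k] by (intro add_mono mult_mono) auto
    finally show ?thesis .
  qed
  have half: "summable (\<lambda>k. (1/2::real) ^ k)" "(\<Sum>k. (1/2::real) ^ k) = 2"
    by (simp_all add: suminf_geometric)
  have s: "summable (\<lambda>k. (1/2) ^ k * \<bar>?u k\<bar>)"
    using u by (intro summable_geometric_mult_bounded[where C = ?R]) simp
  have "weighted_form \<psi> f g - weighted_form \<psi> f' g' = (\<Sum>k. (1/2) ^ k * ?u k)"
    using suminf_diff[OF summable_weighted_form[OF V(1,2)] summable_weighted_form[OF V(3,4)]]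
    by (simp add: weighted_form_def algebra_simps)
  also have "\<bar>\<dots>\<bar> \<le> (\<Sum>k. (1/2) ^ k * \<bar>?u k\<bar>)"
    using summable_rabs[of "\<lambda>k. (1/2) ^ k * ?u k"] s by (simp add: abs_mult)
  also have "\<dots> \<le> (\<Sum>k. (1/2) ^ k * ?R)"
    using u by (intro suminf_le s summable_mult2 half mult_left_mono) auto
  also have "\<dots> = 2 * ?R"
    using suminf_mult2[OF half(1), of ?R] half(2) by simp
  finally show ?thesis .
qed

end

lemma continuous_map_weighted_form_dual:
  fixes \<psi> :: "nat \<Rightarrow> real \<Rightarrow> real ^ 'n"
  assumes T: "T > 0" and \<psi>: "\<And>k. \<psi> k \<in> C1_00 T" "\<And>k. C1_norm T (\<psi> k) \<le> 1"
  shows "continuous_map (prod_topology (dual_topology T) (dual_topology T)) euclideanreal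
    (\<lambda>(L, M). weighted_form \<psi> L M)"
proof -
  interpret Metric_space "C1_dual T :: ((real \<Rightarrow> real ^ 'n) \<Rightarrow> real) set" "dual_dist T"
    by (rule Metric_space_dual[OF T])
  let ?D = "dual_topology T :: ((real \<Rightarrow> real ^ 'n) \<Rightarrow> real) topology"
  note le = C1_dual_diff_le_dist[OF T _ _ \<psi>]
  have le0: "\<bar>L (\<psi> k)\<bar> \<le> dual_dist T L (\<lambda>x. 0)" if "L \<in> C1_dual T" for L k
    using le[OF that zero_in_C1_dual] by simp
  have bdd: "\<exists>C. \<forall>k. \<bar>L (\<psi> k)\<bar> \<le> C" if "L \<in> C1_dual T" for L
    using le0[OF that] by blast
  show ?thesis
    unfolding continuous_map_atin limitin_canonical_iff
  proof (rule ballI, clarsimp simp: dual_topology_def)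
    fix L0 M0 :: "(real \<Rightarrow> real ^ 'n) \<Rightarrow> real"
    assume LM0: "L0 \<in> C1_dual T" "M0 \<in> C1_dual T"
    let ?F = "atin (prod_topology mtopology mtopology) (L0, M0)"
    have "limitin mtopology fst L0 ?F" "limitin mtopology snd M0 ?F"
      using continuous_map_fst[of mtopology mtopology] continuous_map_snd[of mtopology mtopology]
        LM0 by (force simp: continuous_map_atin)+
    \<comment> \<open>Membership is recorded separately because \<open>dual_dist\<close> is 0
      outside the carrier, so small distances alone do not imply it.\<close>
    then have ev: "\<forall>\<^sub>F z in ?F. fst z \<in> C1_dual T" "\<forall>\<^sub>F z in ?F. snd z \<in> C1_dual T"
      and lim: "((\<lambda>z. dual_dist T (fst z) L0) \<longlongrightarrow> 0) ?F" "((\<lambda>z. dual_dist T (snd z) M0) \<longlongrightarrow> 0) ?F"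
      by (simp_all add: limitin_metric_dist_null)
    \<comment> \<open>This is the bound of \<open>weighted_form_diff_le\<close>, with the distances
      to \<open>L0\<close> and \<open>M0\<close> as \<open>a\<close> and \<open>b\<close>, and the
      dual norms of \<open>L0\<close> and \<open>M0\<close>, written as distances to the zero
      functional, as \<open>C\<close> and \<open>D\<close>.\<close>
    let ?R = "\<lambda>z. 2 * (dual_dist T (fst z) L0 * (dual_dist T (snd z) M0 + dual_dist T M0 (\<lambda>x. 0))
      + dual_dist T L0 (\<lambda>x. 0) * dual_dist T (snd z) M0)"
    have "(?R \<longlongrightarrow> 2 * (0 * (0 + dual_dist T M0 (\<lambda>x. 0)) + dual_dist T L0 (\<lambda>x. 0) * 0)) ?F"
      by (intro tendsto_intros lim)
    then have R: "(?R \<longlongrightarrow> 0) ?F" by simp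
    have "\<forall>\<^sub>F z in ?F. norm (weighted_form \<psi> (fst z) (snd z) - weighted_form \<psi> L0 M0) \<le> ?R z"
      using ev
    proof eventually_elim
      case (elim z)
      show ?case
        unfolding real_norm_def
        using bdd elim LM0 by (intro weighted_form_diff_le[where V = "C1_dual T"] le le0)
    qed
    from Lim_null_comparison[OF this R]
    show "((\<lambda>(L, M). weighted_form \<psi> L M) \<longlongrightarrow> weighted_form \<psi> L0 M0) ?F"
      by (simp add: split_beta LIM_zero_cancel)
  qed
qed

theorem lemma5p12:
  fixes T :: real
  assumes "T > 0"
  shows "\<exists>B. inner_product_on (C1_dual T :: ((real \<Rightarrow> real ^ 'n) \<Rightarrow> real) set) B \<and>
             continuous_map (prod_topology (dual_topology T) (dual_topology T)) euclideanreal
               (\<lambda>(L, M). B L M)"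
proof -
  obtain \<psi> :: "nat \<Rightarrow> real \<Rightarrow> real ^ 'n"
    where \<psi>: "\<And>k. \<psi> k \<in> C1_00 T" "\<And>k. C1_norm T (\<psi> k) \<le> 1"
      and sep: "\<And>L. L \<in> C1_dual T \<Longrightarrow> (\<And>k. L (\<psi> k) = 0) \<Longrightarrow> L = (\<lambda>x. 0)"
    using separating_sequence_in_unit_ball[OF assms] by metis
  have "\<exists>C. \<forall>k. \<bar>L (\<psi> k)\<bar> \<le> C" if "L \<in> C1_dual T" for L
    using C1_dual_diff_le_dist[OF assms that zero_in_C1_dual \<psi>] by auto
  then have "inner_product_on (C1_dual T) (weighted_form \<psi>)"
    using sep by (rule inner_product_on_weighted_form)
  with continuous_map_weighted_form_dual[where \<psi> = \<psi>, OF assms \<psi>] show ?thesis by blast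
qed

end
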